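(* For every $m\in\mathbb{N}$, the set $\mathrm{MARS}_m$ is convex. The increasing union $\mathrm{MARS}=\bigcup_{m\in\mathbb{N}}\mathrm{MARS}_m$ is also convex.
   Context: $\mathbb{N}=\{1,2,\dots\}$. For $m\in\mathbb{N}$ and $a\in\mathbb{C}$, $\mathcal{M}_m(a)\in\mathbb{C}^{m\times m}$ is the matrix whose $i$-th row, for $1\le i\le m-1$, has entry $1$ in column $i+1$ and zeros elsewhere, and whose last row has all entries equal to $\frac{a}{m}$. $\sigma(\cdot)$ denotes the spectrum and $B_1(0)=\{z\in\mathbb{C}:|z|<1\}$. $\mathrm{MARS}_m:=\{a\in\mathbb{C}:\sigma(\mathcal{M}_m(a))\subseteq B_1(0)\}$. *)

theory Defs
  imports "HOL-Analysis.Analysis" "Jordan_Normal_Form.Spectral_Radius"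
begin

text \<open>The dimension \<open>m\<close> ranges over the positive integers, that is \<open>m \<ge> 1\<close>.
  Indices of \<^type>\<open>Matrix.mat\<close> start at 0, so row \<open>m - 1\<close> is the last row.\<close>

definition mars_matrix :: "nat \<Rightarrow> complex \<Rightarrow> complex Matrix.mat" where
  "mars_matrix m a = Matrix.mat m m
     (\<lambda>(i, j). if i < m - 1 then (if j = i + 1 then 1 else 0) else a / of_nat m)"

definition MARS_m :: "nat \<Rightarrow> complex set" where
  "MARS_m m = {a. spectrum (mars_matrix m a) \<subseteq> ball 0 1}"

definition MARS :: "complex set" where
  "MARS = (\<Union>m\<in>{1..}. MARS_m m)"

end

theory Submission
  imports Defs "HOL-Complex_Analysis.Conformal_Mappings"
begin

text \<open>Substituting \<open>z = 1 / \<lambda>\<close> in the characteristic equation, \<open>a \<in> MARS_m m\<close> means that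
  \<open>g(z) = (a / m) (z + \<dots> + z^m)\<close> omits the value 1 on the closed unit disc. On the unit circle the
  argument of \<open>g\<close> increases strictly, so a value \<open>s > 0\<close> of \<open>g\<close> on the disc can always be lowered,
  and by the open mapping theorem it can be raised until it is attained on the circle. Hence only
  the largest positive value of \<open>g\<close> on the circle matters, and for \<open>a = r cis t\<close> with
  \<open>0 \<le> t \<le> pi\<close> the condition becomes \<open>r u_m(t) < 1\<close>, where
  \<open>u_m(t) = sin (t - x) / (m sin x)\<close> and \<open>x = t / (m + 1)\<close>. As a quotient of the values of
  \<open>sin y / y\<close> at \<open>t - x\<close> and at \<open>x\<close>, \<open>u_m(t)\<close> decreases in \<open>m\<close>, which gives monotonicity. For
  convexity, every tangent line of the polar curve \<open>r = 1 / u_m(t)\<close> is a supporting line; this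
  reduces to elementary inequalities between \<open>sin t\<close> and \<open>sin (k t)\<close> with \<open>k = 1 / (m + 1)\<close>.\<close>

section \<open>The radial function of the region\<close>

lemma sin_mult_ge:
  fixes k t :: real
  assumes "0 \<le> k" "k \<le> 1" "0 \<le> t" "t \<le> pi"
  shows "k * sin t \<le> sin (k * t)"
proof -
  have "(\<lambda>t. sin (k * t) - k * sin t) 0 \<le> (\<lambda>t. sin (k * t) - k * sin t) t"
  proof (rule DERIV_nonneg_imp_nondecreasing[OF \<open>0 \<le> t\<close>], intro exI conjI)
    fix s assume s: "0 \<le> s" "s \<le> t"
    show "((\<lambda>t. sin (k * t) - k * sin t) has_real_derivative k * (cos (k * s) - cos s)) (at s)"
      by (auto intro!: derivative_eq_intros simp: algebra_simps)
    have "k * s \<le> s" using assms s by (simp add: mult_left_le_one_le)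
    then have "cos s \<le> cos (k * s)"
      using assms s by (intro cos_monotone_0_pi_le) auto
    then show "0 \<le> k * (cos (k * s) - cos s)" using assms by simp
  qed
  then show ?thesis by simp
qed

text \<open>In the interior, dividing by both sines gives
  \<open>cot t \<le> k * cot (k * t)\<close>: the logarithmic derivative of
  \<open>sin t / sin (k * t)\<close> is nonpositive. The cleared difference vanishes at 0 and has a
  nonnegative derivative.\<close>

lemma cos_mult_sin_le:
  fixes k t :: real
  assumes "0 \<le> k" "k \<le> 1" "0 \<le> t" "t \<le> pi"
  shows "cos t * sin (k * t) \<le> k * sin t * cos (k * t)"
proof -
  let ?f = "\<lambda>t. k * sin t * cos (k * t) - cos t * sin (k * t)"
  have "?f 0 \<le> ?f t"
  proof (rule DERIV_nonneg_imp_nondecreasing[OF \<open>0 \<le> t\<close>], intro exI conjI)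
    fix s assume s: "0 \<le> s" "s \<le> t"
    show "(?f has_real_derivative (1 - k^2) * (sin s * sin (k * s))) (at s)"
      by (auto intro!: derivative_eq_intros simp: algebra_simps power2_eq_square)
    have "k * s \<le> s" using assms s by (simp add: mult_left_le_one_le)
    then have "0 \<le> sin s" "0 \<le> sin (k * s)"
      using assms s by (auto intro!: sin_ge_zero)
    moreover have "k^2 \<le> 1" using assms by (simp add: power_le_one)
    ultimately show "0 \<le> (1 - k^2) * (sin s * sin (k * s))" by simp
  qed
  then show ?thesis by simp
qed

text \<open>Cleared form of the decrease of \<open>sin t / sin (k * t)\<close>. The addition
  formulas split the difference into three products, with signs from the decrease of cos and the two
  preceding lemmas; \<open>k \<le> 1/2\<close> keeps \<open>cos (k * s)\<close> nonnegative.\<close>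

lemma sin_cross_antimono:
  fixes k s d :: real
  assumes k: "0 \<le> k" "k \<le> 1/2" and s: "0 \<le> s" "0 \<le> d" "s + d \<le> pi"
  shows "sin (s + d) * sin (k * s) \<le> sin s * sin (k * (s + d))"
proof -
  have ks: "k * s \<le> pi / 2"
    using mult_mono[of k "1/2" s pi] assms by simp
  have kd: "k * d \<le> d" using assms by (simp add: mult_left_le_one_le)
  have pos: "0 \<le> sin s" "0 \<le> sin d" "0 \<le> sin (k * s)" "0 \<le> cos (k * s)"
    using assms ks by (auto intro!: sin_ge_zero cos_ge_zero order_trans[OF _ mult_nonneg_nonneg[of k s]])
  have "cos d \<le> cos (k * d)"
    using assms kd by (intro cos_monotone_0_pi_le) auto
  then have 1: "0 \<le> sin s * sin (k * s) * (cos (k * d) - cos d)" using pos by simp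
  have "0 \<le> sin s * cos (k * s) * (sin (k * d) - k * sin d)"
    using sin_mult_ge[of k d] assms pos by simp
  moreover have "0 \<le> sin d * (k * sin s * cos (k * s) - cos s * sin (k * s))"
    using cos_mult_sin_le[of k s] assms pos by simp
  moreover have "sin s * sin (k * (s + d)) - sin (s + d) * sin (k * s)
     = sin s * sin (k * s) * (cos (k * d) - cos d) + sin s * cos (k * s) * (sin (k * d) - k * sin d)
       + sin d * (k * sin s * cos (k * s) - cos s * sin (k * s))"
    by (simp add: distrib_left sin_add algebra_simps)
  ultimately show ?thesis using 1 by linarith
qed

text \<open>For \<open>F t = k * sin t / sin (k * t)\<close> this is submultiplicativity,
  \<open>F (s + d) \<le> F s * F d\<close>, with denominators cleared. Expansion leaves two terms,
  each an instance of \<open>cos_mult_sin_le\<close>.\<close>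

lemma sin_cross_submult:
  fixes k s d :: real
  assumes k: "0 \<le> k" "k \<le> 1/2" and s: "0 \<le> s" "0 \<le> d" "s + d \<le> pi"
  shows "sin (s + d) * sin (k * s) * sin (k * d) \<le> k * sin s * sin d * sin (k * (s + d))"
proof -
  have "k * s \<le> s" "k * d \<le> d" using assms by (auto simp add: mult_left_le_one_le)
  then have pos: "0 \<le> sin s" "0 \<le> sin d" "0 \<le> sin (k * s)" "0 \<le> sin (k * d)"
    using assms by (auto intro!: sin_ge_zero)
  have "0 \<le> sin d * sin (k * d) * (k * sin s * cos (k * s) - cos s * sin (k * s))"
    using cos_mult_sin_le[of k s] assms pos by simp
  moreover have "0 \<le> sin s * sin (k * s) * (k * sin d * cos (k * d) - cos d * sin (k * d))"
    using cos_mult_sin_le[of k d] assms pos by simp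
  moreover have "k * sin s * sin d * sin (k * (s + d)) - sin (s + d) * sin (k * s) * sin (k * d)
     = sin d * sin (k * d) * (k * sin s * cos (k * s) - cos s * sin (k * s))
       + sin s * sin (k * s) * (k * sin d * cos (k * d) - cos d * sin (k * d))"
    by (simp add: distrib_left sin_add algebra_simps)
  ultimately show ?thesis by linarith
qed

section \<open>The reciprocal radius and its decrease in \<open>m\<close>\<close>

text \<open>With \<open>x = t / (m + 1)\<close> the argument \<open>m * t / (m + 1)\<close> is \<open>t - x\<close>; the value at 0 is the limit.\<close>

definition gauge_fn :: "nat \<Rightarrow> real \<Rightarrow> real" where
  "gauge_fn m t = (if t = 0 then 1
     else sin (m * t / (m + 1)) / (m * sin (t / (m + 1))))"

lemma gauge_fn_eq:
  assumes "t \<noteq> 0"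
  shows "gauge_fn m t = sin (t - t / (m + 1)) / (m * sin (t / (m + 1)))"
proof -
  have "t - t / (real m + 1) = real m * t / (real m + 1)" by (simp add: field_simps)
  then show ?thesis using assms by (simp only: gauge_fn_def if_False)
qed

lemma sin_over_antimono:
  fixes s t :: real
  assumes "0 < s" "s \<le> t" "t \<le> pi"
  shows "sin t / t \<le> sin s / s"
  using sin_mult_ge[of "s / t" t] assms by (simp add: field_simps)

lemma gauge_fn_antimono:
  assumes m: "1 \<le> m" "m \<le> n" and t: "0 \<le> t" "t \<le> pi"
  shows "gauge_fn n t \<le> gauge_fn m t"
proof (cases "t = 0")
  case True
  then show ?thesis by (simp add: gauge_fn_def)
next
  case False
  with t have t: "0 < t" "t \<le> pi" by auto
  define x y where "x = t / (m + 1)" and "y = t / (n + 1)"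
  have "x \<le> t / 2" using m t unfolding x_def by (intro divide_left_mono) auto
  then have "x < pi" using t by simp
  have xy: "0 < y" "y \<le> x"
    using m t by (auto simp: x_def y_def field_simps)
  have mx: "m * x = t - x" and ny: "n * y = t - y"
    by (simp_all add: x_def y_def field_simps)
  have "0 < m * x" using m xy by simp
  then have mxp: "0 < m * x" "m * x \<le> n * y" "n * y \<le> pi"
    using m t xy mx ny by auto
  have sx: "0 < sin x" "0 < sin y" using xy \<open>x < pi\<close> by (auto intro!: sin_gt_zero)
  have "sin (n * y) / (n * y) \<le> sin (m * x) / (m * x)"
    using mxp by (intro sin_over_antimono)
  moreover have "y / sin y \<le> x / sin x"
    using sin_over_antimono[of y x] xy \<open>x < pi\<close> sx by (simp add: field_simps)
  moreover have "0 \<le> sin (n * y)" using mxp by (intro sin_ge_zero) auto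
  \<comment> \<open>Cancelling \<open>y\<close> and \<open>x\<close> turns the two sides into the
    gauge values for \<open>n\<close> and \<open>m\<close>. As the index grows,
    \<open>m * x = t - x\<close> increases while \<open>x\<close> decreases, so both factors
    shrink.\<close>
  ultimately have "sin (n * y) / (n * y) * (y / sin y) \<le> sin (m * x) / (m * x) * (x / sin x)"
    using xy sx mxp by (intro mult_mono) (auto intro!: divide_nonneg_nonneg sin_ge_zero)
  then show ?thesis
    using t xy by (simp add: gauge_fn_def x_def y_def ac_simps)
qed

section \<open>Supporting lines of the polar curve\<close>

text \<open>The line \<open>p * x + q * y = 1\<close> is tangent at angle \<open>t\<close> to the
  curve of radius \<open>1 / gauge_fn m\<close>, and the upper half of the curve lies beneath it.
  The sign of \<open>q\<close> later carries the bound over to the lower half plane.\<close>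

lemma gauge_fn_support:
  assumes m: "1 \<le> m" and t: "0 \<le> t" "t \<le> pi"
  obtains p q where "0 \<le> q" "p * cos t + q * sin t = gauge_fn m t"
    "\<And>s. 0 \<le> s \<Longrightarrow> s \<le> pi \<Longrightarrow> p * cos s + q * sin s \<le> gauge_fn m s"
proof -
  define k where "k = 1 / (real m + 1)"
  have k: "0 < k" "k \<le> 1/2" using m by (auto simp: k_def field_simps)
  have mk: "m = 1 / k - 1" by (simp add: k_def)
  have ev: "gauge_fn m s = (sin s * cos (k * s) / sin (k * s) - cos s) / m" "0 < sin (k * s)" "0 < k * s" "k * s \<le> pi / 2"
    if "0 < s" "s \<le> pi" for s
  proof -
    show "0 < k * s" "k * s \<le> pi / 2"
      using mult_mono[of k "1/2" s pi] k that by auto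
    then show *: "0 < sin (k * s)" by (intro sin_gt_zero) auto
    show "gauge_fn m s = (sin s * cos (k * s) / sin (k * s) - cos s) / m"
    proof -
      have "gauge_fn m s = sin (s - k * s) / (m * sin (k * s))"
        using that by (simp add: gauge_fn_eq k_def)
      then show ?thesis using * m by (simp add: sin_diff field_simps)
    qed
  qed
  show thesis
  proof (cases "t = 0")
    case True
    show ?thesis
    \<comment> \<open>The quotient formula degenerates at angle 0; the tangent there is vertical,
      with \<open>p = 1\<close> and \<open>q = 0\<close> (\<open>q\<close> is instantiated
      first).\<close>
    proof (rule that[of 0 1])
      fix s :: real assume s: "0 \<le> s" "s \<le> pi"
      show "1 * cos s + 0 * sin s \<le> gauge_fn m s"
      proof (cases "s = 0")
        case True then show ?thesis by (simp add: gauge_fn_def)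
      next
        case False
        then have s0: "0 < s" using s by simp
        have "cos s \<le> k * (sin s * cos (k * s) / sin (k * s))"
          using ev(2)[OF s0 s(2)] cos_mult_sin_le[of k s] s k by (simp add: field_simps)
        then have "(real m + 1) * cos s \<le> (real m + 1) * (k * (sin s * cos (k * s) / sin (k * s)))"
          by (intro mult_left_mono) auto
        then have "(real m + 1) * cos s \<le> sin s * cos (k * s) / sin (k * s)"
          using m by (simp add: mult.assoc[symmetric] k_def)
        then show ?thesis
          unfolding ev(1)[OF s0 s(2)] using m by (simp add: pos_le_divide_eq algebra_simps)
      qed
    qed (use True in \<open>auto simp: gauge_fn_def\<close>)
  next
    case False
    define A where "A = sin (k * t)"
    \<comment> \<open>With \<open>u = gauge_fn m\<close> and derivative \<open>u'\<close>, the
      tangent has \<open>p = u t * cos t - u' t * sin t\<close> and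
      \<open>q = u t * sin t + u' t * cos t\<close>; the formula in \<open>ev\<close> gives these
      closed forms.\<close>
    define p where "p = (k * (sin t)^2 / A^2 - 1) / m"
    define q where "q = (A * cos (k * t) - k * sin t * cos t) / A^2 / m"
    have t0: "0 < t" using False t by simp
    have A: "0 < A" "0 \<le> cos (k * t)" using ev[OF t0 t(2)] by (auto simp: A_def intro!: cos_ge_zero)
    have kA: "k * sin t \<le> A" using sin_mult_ge[of k t] k t by (simp add: A_def)
    have st: "0 \<le> sin t" using t by (intro sin_ge_zero)
    show ?thesis
    proof (rule that[of q p])
      \<comment> \<open>Nonnegativity of the numerator of \<open>q\<close>: up to
        \<open>pi / 2\<close> it is \<open>sin_mult_ge\<close> at the doubled angle, beyond that
        \<open>cos t \<le> 0\<close>.\<close>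
      have "k * sin t * cos t \<le> A * cos (k * t)"
      proof (cases "t \<le> pi / 2")
        case True
        then have "k * sin (2 * t) \<le> sin (2 * (k * t))"
          using sin_mult_ge[of k "2 * t"] k t by (simp add: mult.left_commute)
        then show ?thesis by (simp add: sin_double A_def)
      next
        case False
        then have "cos t \<le> 0" using t cos_monotone_0_pi_le[of "pi / 2" t] by simp
        then have "k * sin t * cos t \<le> 0" using k st by (simp add: mult_nonneg_nonpos)
        also have "0 \<le> A * cos (k * t)" using A by simp
        finally show ?thesis .
      qed
      then show "0 \<le> q" by (simp add: q_def)
      show "p * cos t + q * sin t = gauge_fn m t"
      proof -
        have "p * cos t + q * sin t = (sin t * cos (k * t) / A - cos t) / m"
          using A m by (simp add: p_def q_def field_simps power2_eq_square)
        then show ?thesis using ev(1)[OF t0 t(2)] by (simp add: A_def)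
      qed
      fix s :: real assume s: "0 \<le> s" "s \<le> pi"
      show "p * cos s + q * sin s \<le> gauge_fn m s"
      proof (cases "s = 0")
        case True
        \<comment> \<open>At \<open>s = 0\<close> the claim reads \<open>p \<le> 1\<close>, which
          amounts to this bound because \<open>m + 1 = 1 / k\<close>.\<close>
        have "(k * sin t)^2 \<le> A^2" using kA k st by (intro power_mono) auto
        then have "k * (sin t)^2 / A^2 \<le> 1 / k"
          using A k by (simp add: field_simps power2_eq_square)
        also have "1 / k = m + 1" by (simp add: k_def)
        finally have "p \<le> 1" using m by (simp add: p_def)
        then show ?thesis using True by (simp add: gauge_fn_def)
      next
        case False
        then have s0: "0 < s" using s by simp
        define B where "B = sin (k * s)"
        have B: "0 < B" using ev[OF s0 s(2)] by (simp add: B_def)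
        \<comment> \<open>This is the claim multiplied by \<open>m * A^2 * B\<close> and rearranged.
          For \<open>s \<le> t\<close> it is a product of two inequalities; for \<open>s > t\<close>
          both differences change sign and submultiplicativity applies.\<close>
        have main: "k * sin t * sin (t - s) * B \<le> sin s * sin (k * (t - s)) * A"
        proof (cases "s \<le> t")
          case True
          have "(k * sin (t - s)) * (sin t * B) \<le> sin (k * (t - s)) * (sin s * A)"
          proof (rule mult_mono)
            show "k * sin (t - s) \<le> sin (k * (t - s))"
              using True s t k by (intro sin_mult_ge) auto
            show "sin t * B \<le> sin s * A"
              using sin_cross_antimono[of k s "t - s"] True s t k by (simp add: A_def B_def)
            have "0 \<le> k * sin (t - s)"
              using True s t k by (auto intro!: mult_nonneg_nonneg sin_ge_zero)
            also have "k * sin (t - s) \<le> sin (k * (t - s))"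
              using True s t k by (intro sin_mult_ge) auto
            finally show "0 \<le> sin (k * (t - s))" .
          qed (use B st in auto)
          then show ?thesis by (simp add: mult_ac)
        next
          case False
          have "sin s * A * sin (k * (s - t)) \<le> k * sin t * sin (s - t) * B"
            using sin_cross_submult[of k t "s - t"] False s t k by (simp add: A_def B_def)
          moreover have "sin (t - s) = - sin (s - t)" "sin (k * (t - s)) = - sin (k * (s - t))"
            by (simp_all add: sin_minus[symmetric] right_diff_distrib del: sin_minus)
          ultimately show ?thesis by (simp add: mult_ac)
        qed
        have "sin (t - s) = sin t * cos s - cos t * sin s"
          "sin (k * (t - s)) = A * cos (k * s) - cos (k * t) * B"
          by (simp_all add: sin_diff A_def B_def right_diff_distrib)
        then have "k * sin t * (sin t * cos s - cos t * sin s) * B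
            \<le> sin s * (A * cos (k * s) - cos (k * t) * B) * A"
          using main by (simp only:)
        then have "(k * (sin t)^2 - A^2) * cos s * B + (A * cos (k * t) - k * sin t * cos t) * sin s * B
            \<le> sin s * cos (k * s) * A^2 - cos s * A^2 * B"
          by (simp add: algebra_simps power2_eq_square)
        then have "((k * (sin t)^2 - A^2) * cos s * B + (A * cos (k * t) - k * sin t * cos t) * sin s * B) / (A^2 * B)
            \<le> (sin s * cos (k * s) * A^2 - cos s * A^2 * B) / (A^2 * B)"
          using A B by (intro divide_right_mono) auto
        then have "m * (p * cos s + q * sin s) \<le> m * gauge_fn m s"
          unfolding ev(1)[OF s0 s(2)] p_def q_def B_def[symmetric] using m A B
          by (simp add: add_divide_distrib diff_divide_distrib distrib_left left_diff_distrib right_diff_distrib)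
        then show ?thesis using m by simp
      qed
    qed
  qed
qed
section \<open>Power sums on the unit circle\<close>

definition power_sum :: "nat \<Rightarrow> complex \<Rightarrow> complex" where
  "power_sum m z = (\<Sum>k=1..m. z ^ k)"

lemma power_sum_holomorphic: "power_sum m holomorphic_on S"
  unfolding power_sum_def[abs_def] by (intro holomorphic_intros)

text \<open>The geometric sum in Dirichlet kernel form, multiplied out so that it also holds where
  \<open>sin x = 0\<close>.\<close>

lemma power_sum_cis:
  "of_real (sin x) * power_sum m (cis (2 * x)) = cis ((real m + 1) * x) * of_real (sin (real m * x))"
proof (induction m)
  case (Suc m)
  define y where "y = (real m + 1) * x"
  have "of_real (sin x) * power_sum (Suc m) (cis (2 * x))
      = cis y * of_real (sin (y - x)) + of_real (sin x) * cis (2 * x) ^ Suc m"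
    using Suc.IH by (simp add: power_sum_def distrib_left y_def algebra_simps)
  also have "cis (2 * x) ^ Suc m = cis y * cis y"
    by (simp only: Complex.DeMoivre) (simp add: y_def cis_mult algebra_simps)
  also have "cis y * of_real (sin (y - x)) + of_real (sin x) * (cis y * cis y)
      = cis y * (of_real (sin (y - x)) + of_real (sin x) * cis y)"
    by (simp add: algebra_simps)
  also have "of_real (sin (y - x)) + of_real (sin x) * cis y = cis x * of_real (sin y)"
    by (auto simp: complex_eq_iff sin_diff algebra_simps)
  also have "cis y * (cis x * of_real (sin y)) = cis ((real (Suc m) + 1) * x) * of_real (sin (Suc m * x))"
    by (simp add: y_def cis_mult algebra_simps)
  finally show ?case .
qed (simp add: power_sum_def)

text \<open>At the angle \<open>-2 * x\<close> the closed form has phase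
  \<open>-(m + 1) * x\<close>; the choice \<open>x = t / (m + 1)\<close> cancels
  \<open>cis t\<close>. This exhibits a circle point at which the bound of
  \<open>power_sum_circle_bound\<close> is attained.\<close>

lemma power_sum_on_ray:
  assumes m: "1 \<le> m" and t: "\<bar>t\<bar> \<le> pi"
  shows "cis t * power_sum m (cis (- 2 * t / (real m + 1))) = of_real (real m * gauge_fn m t)"
proof (cases "t = 0")
  case True
  then show ?thesis by (simp add: gauge_fn_def power_sum_def)
next
  case False
  define x where "x = t / (real m + 1)"
  have "\<bar>x\<bar> < pi" "x \<noteq> 0" using t m False
    by (auto simp: x_def abs_divide field_simps add_pos_nonneg intro: order.strict_trans1)
  then have sx: "sin x \<noteq> 0" using sin_eq_0_pi[of x] by (auto simp: abs_less_iff)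
  have x: "(real m + 1) * x = t" "real m * x = t - x" by (auto simp: x_def field_simps)
  have "of_real (sin x) * power_sum m (cis (2 * (-x))) = cis (- t) * of_real (sin (real m * x))"
    using power_sum_cis[of "-x" m]
    by (simp only: x(1)[symmetric] sin_minus mult_minus_right of_real_minus mult_minus_left
        neg_equal_iff_equal)
  then have "power_sum m (cis (2 * (-x))) = cis (- t) * of_real (sin (real m * x) / sin x)"
    using sx by (simp add: field_simps)
  then have "cis t * power_sum m (cis (2 * (-x))) = of_real (sin (real m * x) / sin x)"
    by (simp add: cis_mult mult.assoc[symmetric])
  moreover have "2 * (-x) = - 2 * t / (real m + 1)" by (simp add: x_def)
  moreover have "m * gauge_fn m t = sin (real m * x) / sin x"
    using m sx x False by (simp add: gauge_fn_eq x_def)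
  ultimately show ?thesis by (simp del: of_real_divide)
qed

lemma power_sum_cnj: "power_sum m (cnj z) = cnj (power_sum m z)"
  by (simp add: power_sum_def)

text \<open>For \<open>z = cis (- 2 * y)\<close>, realness makes \<open>t - (m + 1) * y\<close> a
  multiple of \<open>pi\<close> and the value becomes \<open>r * sin (t - y) / (m * sin y)\<close>.
  This decreases in \<open>y\<close>, and the smallest admissible \<open>y\<close> is
  \<open>t / (m + 1)\<close>.\<close>

lemma power_sum_circle_bound:
  assumes m: "1 \<le> m" and z: "norm z = 1" and r: "0 < r" and t: "0 \<le> t" "t \<le> pi"
    and s: "0 < s" and eq: "of_real r * cis t * power_sum m z = of_real (real m * s)"
  shows "s \<le> r * gauge_fn m t"
proof (cases "z = 1")
  case True
  then have "cis t = of_real (s / r)"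
    using eq m r by (simp add: power_sum_def field_simps)
  then have sc: "sin t = 0" "cos t = s / r" by (auto simp: complex_eq_iff)
  have "cos t \<noteq> -1" using sc s r by (auto simp: field_simps)
  then have "t \<noteq> pi" by auto
  then have "t = 0" using t sc sin_gt_zero[of t] by (cases "0 < t") auto
  then show ?thesis using sc r by (simp add: gauge_fn_def)
next
  case False
  obtain w where w: "z = cis w" "0 \<le> w" "w < 2 * pi"
    by (rule that[of "Arg2pi z"])
      (use Arg2pi[of z] z in \<open>auto simp: cis_conv_exp is_Arg_def mult.commute\<close>)
  \<comment> \<open>Half the clockwise angle of \<open>z\<close>; excluding \<open>z = 1\<close>
    places it strictly between 0 and \<open>pi\<close>, where the sine is positive.\<close>
  define y where "y = pi - w / 2"
  have y: "0 < y" "y < pi" using w False by (auto simp: y_def) (cases "w = 0"; auto)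
  have zy: "z = cis (2 * (- y))"
    using w by (simp add: y_def cis_divide[symmetric] right_diff_distrib)
  have sy: "0 < sin y" using y by (intro sin_gt_zero)
  have "of_real (sin y) * power_sum m z = cis (- ((real m + 1) * y)) * of_real (sin (real m * y))"
    using power_sum_cis[of "-y" m] by (simp add: zy)
  then have "of_real r * (cis t * cis (- ((real m + 1) * y))) * of_real (sin (real m * y))
      = of_real r * cis t * power_sum m z * of_real (sin y)"
    by (simp add: algebra_simps)
  then have *: "of_real r * cis (t - (real m + 1) * y) * of_real (sin (real m * y)) = of_real (real m * s * sin y)"
    using eq by (simp add: cis_mult)
  then have im: "r * sin (t - (real m + 1) * y) * sin (real m * y) = 0"
    and re: "r * cos (t - (real m + 1) * y) * sin (real m * y) = m * s * sin y"
    by (auto simp: complex_eq_iff)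
  have pos: "0 < m * s * sin y" using m s sy by simp
  then have sin0: "sin (t - (real m + 1) * y) = 0" using im re r by auto
  have "sin (t - y) = sin (real m * y + (t - (real m + 1) * y))" by (simp add: algebra_simps)
  also have "\<dots> = cos (t - (real m + 1) * y) * sin (real m * y)" using sin0 by (subst sin_add) simp
  finally have ty: "r * sin (t - y) = m * s * sin y" using re by simp
  obtain j :: int where j: "t - (real m + 1) * y = j * pi" using sin0 by (auto simp: sin_zero_iff_int2)
  \<comment> \<open>A multiple \<open>j \<ge> 1\<close> would give
    \<open>j * pi \<ge> pi \<ge> t\<close>, contradicting \<open>y > 0\<close>.\<close>
  have "j < 1"
  proof (rule ccontr)
    assume "\<not> j < 1"
    then have "1 * pi \<le> j * pi" by (intro mult_right_mono) auto
    then have "(real m + 1) * y \<le> 0" using j t by linarith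
    then show False using y by (simp add: mult_le_0_iff)
  qed
  then have "j * pi \<le> 0 * pi" by (intro mult_right_mono) auto
  then have ty': "t \<le> (real m + 1) * y" using j by simp
  define x where "x = t / (real m + 1)"
  have xy: "x \<le> y" using ty' by (simp add: x_def field_simps)
  have "0 < r * sin (t - y)" using ty pos by simp
  then have "0 < sin (t - y)" using r by (simp add: zero_less_mult_iff)
  then have "t \<noteq> 0" using sy by auto
  then have x0: "0 < x" using t by (simp add: x_def)
  then have sx: "0 < sin x" using xy y by (intro sin_gt_zero) auto
  \<comment> \<open>The cleared form of the decrease of
    \<open>sin (t - y) / sin y = sin t * cot y - cos t\<close>.\<close>
  have "0 \<le> sin t * sin (y - x)" using t xy x0 y by (intro mult_nonneg_nonneg sin_ge_zero) auto
  also have "\<dots> = sin (t - x) * sin y - sin (t - y) * sin x"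
    by (simp add: sin_diff algebra_simps)
  finally have "sin (t - y) / sin y \<le> sin (t - x) / sin x"
    using sx sy by (simp add: field_simps)
  then have "(r / m) * (sin (t - y) / sin y) \<le> (r / m) * (sin (t - x) / sin x)"
    using r by (intro mult_left_mono) auto
  moreover have "(r / m) * (sin (t - y) / sin y) = s" using ty sy m by (simp add: field_simps)
  moreover have "(r / m) * (sin (t - x) / sin x) = r * gauge_fn m t"
    using \<open>t \<noteq> 0\<close> by (simp add: gauge_fn_eq x_def)
  ultimately show ?thesis by simp
qed

text \<open>The palindromic symmetry \<open>k \<mapsto> m + 1 - k\<close> gives \<open>z^(m+1) * cnj S = S\<close> on the unit circle,
  and turns \<open>w = z * S' / S\<close> into \<open>cnj w = m + 1 - w\<close>.\<close>

lemma power_sum_angular_deriv: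
  assumes m: "1 \<le> m" and z: "norm z = 1" and nz: "power_sum m z \<noteq> 0"
  shows "Re (z * deriv (power_sum m) z / power_sum m z) = (m + 1) / 2"
proof -
  have d: "(power_sum m has_field_derivative (\<Sum>k=1..m. of_nat k * z ^ (k - 1))) (at z)"
    unfolding power_sum_def[abs_def] by (auto intro!: derivative_eq_intros)
  define T where "T = z * deriv (power_sum m) z"
  have T: "T = (\<Sum>k=1..m. of_nat k * z ^ k)"
    unfolding T_def DERIV_imp_deriv[OF d] sum_distrib_left
    by (intro sum.cong refl) (auto simp: power_eq_if mult_ac)
  have zc: "z * cnj z = 1" using z by (simp add: complex_norm_square[symmetric] )
  have pw: "z ^ (m + 1) * cnj z ^ k = z ^ (m + 1 - k)" if "k \<le> m" for k
  proof -
    have "z ^ (m + 1) = z ^ (m + 1 - k) * z ^ k" using that by (simp flip: power_add)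
    then show ?thesis using zc by (simp add: mult.assoc flip: power_mult_distrib)
  qed
  have S: "z ^ (m + 1) * cnj (power_sum m z) = power_sum m z"
  proof -
    have "z ^ (m + 1) * cnj (power_sum m z) = (\<Sum>k=1..m. z ^ (m + 1 - k))"
      unfolding power_sum_def cnj_sum sum_distrib_left complex_cnj_power
      by (intro sum.cong refl pw) auto
    also have "\<dots> = power_sum m z" unfolding power_sum_def by (subst (2) sum.atLeastAtMost_rev) simp
    finally show ?thesis .
  qed
  have "z ^ (m + 1) * cnj T = (\<Sum>k=1..m. of_nat k * z ^ (m + 1 - k))"
    unfolding T cnj_sum sum_distrib_left complex_cnj_mult complex_cnj_power mult.left_commute[of "z^(m+1)"]
    by (intro sum.cong refl) (use pw in auto)
  also have "\<dots> = (\<Sum>k=1..m. of_nat (m + 1 - k) * z ^ k)"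
    by (subst (2) sum.atLeastAtMost_rev) simp
  also have "\<dots> = (\<Sum>k=1..m. (of_nat (m + 1) * z ^ k - of_nat k * z ^ k))"
    by (intro sum.cong refl) (auto simp: of_nat_diff algebra_simps)
  also have "\<dots> = of_nat (m + 1) * power_sum m z - T"
    by (simp add: T power_sum_def sum_subtractf sum_distrib_left)
  finally have T2: "z ^ (m + 1) * cnj T = of_nat (m + 1) * power_sum m z - T" .
  have z0: "z \<noteq> 0" using z by auto
  have "cnj (T / power_sum m z) = (z ^ (m + 1) * cnj T) / (z ^ (m + 1) * cnj (power_sum m z))"
    using z0 by simp
  also have "\<dots> = of_nat (m + 1) - T / power_sum m z"
    unfolding S T2 using nz by (simp add: field_simps)
  finally have "Re (cnj (T / power_sum m z)) = Re (of_nat (m + 1) - T / power_sum m z)" by simp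
  then have "2 * Re (T / power_sum m z) = m + 1" by (simp del: complex_cnj_divide)
  then show ?thesis by (simp add: T_def)
qed
section \<open>The spectrum of the matrix\<close>

unbundle no vec_syntax

text \<open>The shift rows force an eigenvector to be a multiple of the geometric vector
  \<open>(1, l, \<dots>, l ^ (m - 1))\<close>; the last row is then the stated equation.\<close>

lemma eigenvalue_mars_matrix:
  assumes m: "1 \<le> m"
  shows "eigenvalue (mars_matrix m a) l \<longleftrightarrow> a * (\<Sum>j<m. l ^ j) = of_nat m * l ^ m"
proof -
  have row: "(mars_matrix m a *\<^sub>v v) $ i =
      (if i < m - 1 then v $ (i + 1) else a / of_nat m * (\<Sum>j<m. v $ j))"
    if v: "v \<in> carrier_vec m" and i: "i < m" for v i
  proof -
    have "(mars_matrix m a *\<^sub>v v) $ i =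
        (\<Sum>j<m. (if i < m - 1 then if j = i + 1 then 1 else 0 else a / of_nat m) * v $ j)"
      using v i by (simp add: mars_matrix_def scalar_prod_def lessThan_atLeast0)
    also have "\<dots> = (if i < m - 1 then v $ (i + 1) else a / of_nat m * (\<Sum>j<m. v $ j))"
    proof (cases "i < m - 1")
      case True
      have "(\<Sum>j<m. (if j = i + 1 then 1 else 0) * v $ j) = (\<Sum>j<m. if j = i + 1 then v $ j else 0)"
        by (intro sum.cong) auto
      then show ?thesis using True by simp
    next
      case False
      then show ?thesis by (simp add: sum_distrib_left)
    qed
    finally show ?thesis .
  qed
  have lm: "l * l ^ (m - 1) = l ^ m" using m by (cases m) auto
  have dim: "dim_row (mars_matrix m a) = m" "dim_col (mars_matrix m a) = m" by (simp_all add: mars_matrix_def)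
  show ?thesis
  proof
    assume "eigenvalue (mars_matrix m a) l"
    then obtain v where v: "v \<in> carrier_vec m" "v \<noteq> 0\<^sub>v m" "mars_matrix m a *\<^sub>v v = l \<cdot>\<^sub>v v"
      by (auto simp: eigenvalue_def eigenvector_def dim)
    have eq: "l * v $ i = (if i < m - 1 then v $ (i + 1) else a / of_nat m * (\<Sum>j<m. v $ j))"
      if "i < m" for i
      using row[OF v(1) that] v that by simp
    have pow: "v $ i = l ^ i * v $ 0" if "i < m" for i
      using that
    proof (induction i)
      case (Suc i)
      have "v $ Suc i = l * v $ i" using eq[of i] Suc.prems by (simp add: less_diff_conv)
      also have "v $ i = l ^ i * v $ 0" using Suc by simp
      finally show ?case by simp
    qed simp
    \<comment> \<open>All entries are multiples of the first one, so it can be cancelled from the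
      last row.\<close>
    have v0: "v $ 0 \<noteq> 0"
    proof
      assume "v $ 0 = 0"
      then have "v = 0\<^sub>v m" using pow v(1) by (intro eq_vecI) auto
      then show False using v(2) by simp
    qed
    have "l * (l ^ (m - 1) * v $ 0) = a / of_nat m * (\<Sum>j<m. v $ j)"
      using eq[of "m - 1"] pow[of "m - 1"] m by simp
    also have "(\<Sum>j<m. v $ j) = (\<Sum>j<m. l ^ j) * v $ 0"
      unfolding sum_distrib_right by (intro sum.cong refl pow) auto
    also have "l * (l ^ (m - 1) * v $ 0) = l ^ m * v $ 0"
      by (simp only: lm mult.assoc[symmetric])
    finally show "a * (\<Sum>j<m. l ^ j) = of_nat m * l ^ m"
      using v0 m by (simp add: field_simps)
  next
    assume eq: "a * (\<Sum>j<m. l ^ j) = of_nat m * l ^ m"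
    define v where "v = Matrix.vec m (\<lambda>i. l ^ i)"
    have v: "v \<in> carrier_vec m" by (simp add: v_def)
    have "mars_matrix m a *\<^sub>v v = l \<cdot>\<^sub>v v"
    proof (rule eq_vecI)
      fix i assume "i < dim_vec (l \<cdot>\<^sub>v v)"
      then have i: "i < m" by (simp add: v_def)
      have "a / of_nat m * (\<Sum>j<m. v $ j) = l ^ m" using eq m by (simp add: v_def field_simps)
      moreover have "l * l ^ i = l ^ m" if "\<not> i < m - 1"
        using that i lm by (cases "i = m - 1") auto
      moreover have "v $ (i + 1) = l * l ^ i" if "i < m - 1" using that by (simp add: v_def)
      moreover have "(l \<cdot>\<^sub>v v) $ i = l * l ^ i" using i by (simp add: v_def)
      ultimately show "(mars_matrix m a *\<^sub>v v) $ i = (l \<cdot>\<^sub>v v) $ i"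
        unfolding row[OF v i] by (simp split: if_split)
    qed (simp add: v_def dim)
    moreover have "v $ 0 \<noteq> 0\<^sub>v m $ 0" using m by (simp add: v_def)
    then have "v \<noteq> 0\<^sub>v m" by metis
    ultimately show "eigenvalue (mars_matrix m a) l"
      using v by (auto simp: eigenvalue_def eigenvector_def dim)
  qed
qed

text \<open>Inversion sends \<open>1 \<le> norm l\<close> to the punctured closed disc, and
  multiplication by \<open>z ^ m\<close> reverses the sum. The added point \<open>z = 0\<close> is
  harmless, since the power sum vanishes there.\<close>

lemma MARS_m_iff:
  assumes m: "1 \<le> m"
  shows "a \<in> MARS_m m \<longleftrightarrow> (\<forall>z. norm z \<le> 1 \<longrightarrow> a * power_sum m z \<noteq> of_nat m)"
proof -
  have inv: "a * power_sum m z = of_nat m \<longleftrightarrow> a * (\<Sum>j<m. (1 / z) ^ j) = of_nat m * (1 / z) ^ m"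
    if "z \<noteq> 0" for z
  proof -
    have "z ^ m * (\<Sum>j<m. (1 / z) ^ j) = (\<Sum>j<m. z ^ (m - j))"
      unfolding sum_distrib_left using that
      by (intro sum.cong refl) (auto simp: power_diff power_divide)
    also have "\<dots> = power_sum m z" unfolding power_sum_def
      by (rule sum.reindex_bij_witness[of _ "\<lambda>k. m - k" "\<lambda>k. m - k"]) auto
    finally have 1: "a * power_sum m z = a * (\<Sum>j<m. (1 / z) ^ j) * z ^ m" by (simp only: mult_ac)
    have 2: "of_nat m = of_nat m * (1 / z) ^ m * z ^ m"
      using that by (simp add: power_divide)
    have "a * power_sum m z = of_nat m \<longleftrightarrow>
        a * (\<Sum>j<m. (1 / z) ^ j) * z ^ m = of_nat m * (1 / z) ^ m * z ^ m"
      by (rule arg_cong2[where f = "(=)", OF 1 2])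
    also have "\<dots> \<longleftrightarrow> a * (\<Sum>j<m. (1 / z) ^ j) = of_nat m * (1 / z) ^ m"
      by (rule mult_right_cancel[OF power_not_zero[OF that]])
    finally show ?thesis .
  qed
  have "a \<in> MARS_m m \<longleftrightarrow> (\<forall>l. 1 \<le> norm l \<longrightarrow> a * (\<Sum>j<m. l ^ j) \<noteq> of_nat m * l ^ m)"
    by (force simp: MARS_m_def spectrum_def eigenvalue_mars_matrix[OF m] subset_iff not_less)
  also have "\<dots> \<longleftrightarrow> (\<forall>z. norm z \<le> 1 \<longrightarrow> a * power_sum m z \<noteq> of_nat m)"
  proof (intro iffI allI impI)
    fix z :: complex
    assume *: "\<forall>l. 1 \<le> norm l \<longrightarrow> a * (\<Sum>j<m. l ^ j) \<noteq> of_nat m * l ^ m" and z: "norm z \<le> 1"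
    show "a * power_sum m z \<noteq> of_nat m"
    proof (cases "z = 0")
      case True
      then show ?thesis using m by (simp add: power_sum_def power_0_left)
    next
      case False
      then show ?thesis using *[rule_format, of "1 / z"] inv[of z] z by (simp add: norm_divide)
    qed
  next
    fix l :: complex
    assume *: "\<forall>z. norm z \<le> 1 \<longrightarrow> a * power_sum m z \<noteq> of_nat m" and l: "1 \<le> norm l"
    then have "l \<noteq> 0" by auto
    then show "a * (\<Sum>j<m. l ^ j) \<noteq> of_nat m * l ^ m"
      using *[rule_format, of "1 / l"] inv[of "1 / l"] l by (simp add: norm_divide)
  qed
  finally show ?thesis .
qed

section \<open>Positive real values of entire functions on the disc\<close>

lemma compact_real_ray_preimage:
  fixes g :: "complex \<Rightarrow> complex"
  assumes "continuous_on UNIV g"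
  shows "compact {z \<in> cball 0 1. Im (g z) = 0 \<and> c \<le> Re (g z)}"
proof -
  have "closed ({z. Im (g z) = 0} \<inter> {z. c \<le> Re (g z)})"
    using assms by (intro closed_Int closed_Collect_eq closed_Collect_le continuous_intros)
  then have "compact (cball 0 1 \<inter> ({z. Im (g z) = 0} \<inter> {z. c \<le> Re (g z)}))"
    by (intro compact_Int_closed compact_cball)
  also have "cball 0 1 \<inter> ({z. Im (g z) = 0} \<inter> {z. c \<le> Re (g z)}) = {z \<in> cball 0 1. Im (g z) = 0 \<and> c \<le> Re (g z)}"
    by auto
  finally show ?thesis .
qed

lemma open_mapping_real_shift:
  assumes g: "g holomorphic_on UNIV" "\<not> g constant_on UNIV" and w: "norm w < 1"
  obtains e where "0 < e" "\<And>d. \<bar>d\<bar> < e \<Longrightarrow> \<exists>z. norm z < 1 \<and> g z = g w + of_real d"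
proof -
  have "open (g ` ball 0 1)" by (rule open_mapping_thm[OF g(1)]) (use g(2) in auto)
  moreover have "g w \<in> g ` ball 0 1" using w by auto
  ultimately obtain e where e: "0 < e" "ball (g w) e \<subseteq> g ` ball 0 1"
    by (meson open_contains_ball)
  show thesis
  proof (rule that[OF e(1)])
    fix d :: real assume "\<bar>d\<bar> < e"
    then have "g w + of_real d \<in> ball (g w) e" by (simp add: dist_norm)
    then show "\<exists>z. norm z < 1 \<and> g z = g w + of_real d" using e(2) by force
  qed
qed

text \<open>Take a point of largest real value at least \<open>c\<close>. If it were interior, the
  open mapping theorem would yield a larger real value in the disc.\<close>

lemma real_value_on_circle:
  assumes g: "g holomorphic_on UNIV" "\<not> g constant_on UNIV"
    and z: "norm z \<le> 1" "g z = of_real c"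
  obtains w t where "norm w = 1" "g w = of_real t" "c \<le> t"
proof -
  define K where "K = {z \<in> cball 0 1. Im (g z) = 0 \<and> c \<le> Re (g z)}"
  have cont: "continuous_on UNIV g" using g(1) by (rule holomorphic_on_imp_continuous_on)
  have "compact K" unfolding K_def using cont by (rule compact_real_ray_preimage)
  moreover have "z \<in> K" using z by (auto simp: K_def)
  moreover have "continuous_on K (\<lambda>z. Re (g z))"
    by (intro continuous_intros continuous_on_subset[OF cont]) auto
  ultimately obtain w where w: "w \<in> K" "\<And>y. y \<in> K \<Longrightarrow> Re (g y) \<le> Re (g w)"
    using continuous_attains_sup[of K "\<lambda>z. Re (g z)"] by blast
  have gw: "g w = of_real (Re (g w))" using w(1) by (auto simp: K_def complex_eq_iff)
  have "\<not> norm w < 1"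
  proof
    assume "norm w < 1"
    then obtain e where e: "0 < e" "\<And>d. \<bar>d\<bar> < e \<Longrightarrow> \<exists>z. norm z < 1 \<and> g z = g w + of_real d"
      using open_mapping_real_shift[OF g] by blast
    then obtain y where y: "norm y < 1" "g y = g w + of_real (e / 2)" using e(2)[of "e / 2"] by auto
    then have "y \<in> K" using w(1) e(1) by (auto simp: K_def)
    then show False using w(2)[of y] y e(1) by simp
  qed
  then have "norm w = 1" using w(1) by (simp add: K_def)
  then show thesis using that gw w(1) by (auto simp: K_def)
qed

text \<open>\<open>Re (w * deriv g w / g w)\<close> is the angular speed of the argument of
  \<open>g\<close> along the circle. When it is positive, following the local inverse from the value
  \<open>t\<close> downwards leads into the disc.\<close>

lemma inward_real_shift:
  assumes g: "g holomorphic_on UNIV" and w: "norm w = 1" and gw: "g w = of_real t" and t: "0 < t"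
    and pos: "0 < Re (w * deriv g w / g w)"
  obtains e where "0 < e" "\<And>d. 0 < d \<Longrightarrow> d < e \<Longrightarrow> \<exists>z. norm z < 1 \<and> g z = of_real (t - d)"
proof -
  have dnz: "deriv g w \<noteq> 0" using pos by auto
  obtain r where r: "0 < r" "open (g ` ball w r)" "inj_on g (ball w r)"
    using has_complex_derivative_locally_invertible[OF g _ open_UNIV dnz] by blast
  obtain h where h: "h holomorphic_on (g ` ball w r)"
      "\<And>z. z \<in> ball w r \<Longrightarrow> deriv g z * deriv h (g z) = 1" "\<And>z. z \<in> ball w r \<Longrightarrow> h (g z) = z"
    using holomorphic_has_inverse[OF holomorphic_on_subset[OF g subset_UNIV] open_ball r(3)] by blast
  define D where "D = deriv h (of_real t)"
  have tin: "of_real t \<in> g ` ball w r" using r(1) gw by (metis centre_in_ball imageI)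
  have hd: "(h has_field_derivative D) (at (of_real t))"
    unfolding D_def using h(1) r(2) tin by (rule holomorphic_derivI)
  have ht: "h (of_real t) = w" using h(3)[of w] r(1) gw by simp
  have Dw: "deriv g w * D = 1" using h(2)[of w] r(1) gw by (simp add: D_def)
  have "((\<lambda>z. h (of_real t - z)) has_field_derivative - D) (at (of_real 0))"
    by (rule DERIV_chain2[of h D, THEN DERIV_cong])
      (use hd in \<open>auto intro!: derivative_eq_intros\<close>)
  then have "((\<lambda>s. h (of_real t - of_real s)) has_vector_derivative - D) (at 0)"
    by (rule has_vector_derivative_real_field)
  then have dR: "((\<lambda>s. Re (h (of_real t - of_real s))) has_real_derivative - Re D) (at 0)"
    and dI: "((\<lambda>s. Im (h (of_real t - of_real s))) has_real_derivative - Im D) (at 0)"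
    by (simp_all add: has_vector_derivative_complex_iff)
  \<comment> \<open>The squared modulus of the preimage of \<open>t - s\<close>; it equals 1 at
    \<open>s = 0\<close> and must be shown to decrease there.\<close>
  define N where "N = (\<lambda>s. (Re (h (of_real t - of_real s)))\<^sup>2 + (Im (h (of_real t - of_real s)))\<^sup>2)"
  have dN: "(N has_real_derivative - 2 * Re (cnj w * D)) (at 0)"
    unfolding N_def by (rule derivative_eq_intros dR dI refl | simp add: ht)+
  have "Re (w * deriv g w) > 0" using pos t by (simp add: gw zero_less_divide_iff)
  moreover have wc: "w * cnj w = 1" using w by (simp add: complex_norm_square[symmetric])
  \<comment> \<open>On the circle \<open>cnj w\<close> is the inverse of \<open>w\<close>, and a
    reciprocal has a real part of the same sign. Hence the angular hypothesis makes \<open>N\<close>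
    decrease.\<close>
  then have "cnj w * D = 1 / (w * deriv g w)"
  proof -
    have "w \<noteq> 0" using w by auto
    then have nz: "w * deriv g w \<noteq> 0" using dnz by simp
    have "cnj w * D * (w * deriv g w) = (w * cnj w) * (deriv g w * D)" by (simp only: mult_ac)
    also have "\<dots> = 1" by (simp only: wc Dw mult_1_left)
    finally show ?thesis by (rule eq_divide_imp[OF nz])
  qed
  ultimately have "Re (cnj w * D) > 0" by (simp only: Re_complex_div_gt_0 mult_1_left cnj.sel)
  then have "- 2 * Re (cnj w * D) < 0" by (simp only: mult_less_0_iff) simp
  then obtain d0 where d0: "0 < d0" "\<And>d. 0 < d \<Longrightarrow> d < d0 \<Longrightarrow> N d < N 0"
    using DERIV_neg_dec_right[OF dN] by (metis add_0)
  obtain e0 where e0: "0 < e0" "ball (of_real t) e0 \<subseteq> g ` ball w r"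
    using r(2) tin by (meson open_contains_ball)
  show thesis
  proof (rule that[of "min d0 e0"])
    fix d assume d: "0 < d" "d < min d0 e0"
    then have "of_real (t - d) \<in> ball (complex_of_real t) e0" by (simp add: dist_norm flip: of_real_diff)
    then obtain z where z: "z \<in> ball w r" "of_real (t - d) = g z" using e0(2) by blast
    have "N d < N 0" using d0(2) d by simp
    moreover have "N d = (norm z)\<^sup>2" using h(3)[OF z(1)] z(2) by (simp add: N_def cmod_power2)
    moreover have "N 0 = 1" using w by (simp add: N_def ht flip: cmod_power2)
    ultimately have "norm z < 1" by (simp add: power2_less_imp_less abs_square_less_1)
    then show "\<exists>z. norm z < 1 \<and> g z = of_real (t - d)" using z(2) by metis
  qed (use d0 e0 in auto)
qed

text \<open>Take a point of smallest real value at least \<open>c\<close>. A value above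
  \<open>c\<close> could be lowered, by the open mapping theorem inside the disc and by
  \<open>inward_real_shift\<close> on its boundary.\<close>

lemma real_value_downward:
  assumes g: "g holomorphic_on UNIV" "\<not> g constant_on UNIV"
    and pos: "\<And>w t. norm w = 1 \<Longrightarrow> g w = of_real t \<Longrightarrow> 0 < t \<Longrightarrow> 0 < Re (w * deriv g w / g w)"
    and z: "norm z \<le> 1" "g z = of_real s" and c: "0 < c" "c \<le> s"
  obtains w where "norm w \<le> 1" "g w = of_real c"
proof -
  define K where "K = {z \<in> cball 0 1. Im (g z) = 0 \<and> c \<le> Re (g z)}"
  have cont: "continuous_on UNIV g" using g(1) by (rule holomorphic_on_imp_continuous_on)
  have "compact K" unfolding K_def using cont by (rule compact_real_ray_preimage)
  moreover have "z \<in> K" using z c by (auto simp: K_def)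
  moreover have "continuous_on K (\<lambda>z. Re (g z))"
    by (intro continuous_intros continuous_on_subset[OF cont]) auto
  ultimately obtain w where w: "w \<in> K" "\<And>y. y \<in> K \<Longrightarrow> Re (g w) \<le> Re (g y)"
    using continuous_attains_inf[of K "\<lambda>z. Re (g z)"] by blast
  define t where "t = Re (g w)"
  have gw: "g w = of_real t" using w(1) by (auto simp: K_def complex_eq_iff t_def)
  have ct: "c \<le> t" using w(1) by (auto simp: K_def t_def)
  have nw: "norm w \<le> 1" using w(1) by (auto simp: K_def)
  have "\<not> c < t"
  proof
    assume "c < t"
    have "\<exists>e>0. \<forall>d. 0 < d \<longrightarrow> d < e \<longrightarrow> (\<exists>z. norm z < 1 \<and> g z = of_real (t - d))"
    proof (cases "norm w < 1")
      case True
      then obtain e where e: "0 < e" "\<And>d. \<bar>d\<bar> < e \<Longrightarrow> \<exists>z. norm z < 1 \<and> g z = g w + of_real d"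
        using open_mapping_real_shift[OF g] by blast
      have "\<exists>z. norm z < 1 \<and> g z = of_real (t - d)" if "0 < d" "d < e" for d
        using e(2)[of "- d"] that gw by simp
      then show ?thesis using e(1) by blast
    next
      case False
      then have "norm w = 1" using nw by simp
      then show ?thesis
        using inward_real_shift[OF g(1) _ gw _ pos[OF _ gw]] c ct by (metis less_le_trans)
    qed
    then obtain e where e: "e > 0" "\<And>d. 0 < d \<Longrightarrow> d < e \<Longrightarrow> \<exists>z. norm z < 1 \<and> g z = of_real (t - d)"
      by blast
    \<comment> \<open>Small enough for the local shift and for the new value to stay at least
      \<open>c\<close>, so the new point remains in \<open>K\<close>.\<close>
    define d where "d = min (e / 2) (t - c)"
    have d: "0 < d" "d < e" "d \<le> t - c" using e(1) \<open>c < t\<close> by (auto simp: d_def)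
    obtain y where y: "norm y < 1" "g y = of_real (t - d)" using e(2)[OF d(1,2)] by blast
    then have "y \<in> K" using d by (auto simp: K_def)
    then show False using w(2)[of y] y d by (simp add: t_def)
  qed
  then show thesis using that nw gw ct by simp
qed
section \<open>Polar description and convexity\<close>

lemma MARS_m_polar_iff:
  assumes m: "1 \<le> m" and r: "0 < r" and t: "0 \<le> t" "t \<le> pi"
  shows "of_real r * cis t \<in> MARS_m m \<longleftrightarrow> r * gauge_fn m t < 1"
proof -
  define a where "a = of_real r * cis t"
  define g where "g = (\<lambda>z. a / of_nat m * power_sum m z)"
  have a0: "a \<noteq> 0" using r by (simp add: a_def)
  have hol: "g holomorphic_on UNIV"
    unfolding g_def by (intro holomorphic_intros power_sum_holomorphic)
  have "g 0 = 0" "g 1 = a" using m by (simp_all add: g_def power_sum_def power_0_left)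
  then have nc: "\<not> g constant_on UNIV" using a0 by (metis UNIV_I constant_on_def)
  have g1: "g z = of_real s \<longleftrightarrow> a * power_sum m z = of_real (real m * s)" for z s
    using m by (simp add: g_def field_simps)
  show ?thesis
  proof
    assume "of_real r * cis t \<in> MARS_m m"
    then have a: "a * power_sum m z \<noteq> of_nat m" if "norm z \<le> 1" for z
      using that MARS_m_iff[OF m] by (auto simp: a_def)
    show "r * gauge_fn m t < 1"
    proof (rule ccontr)
      assume "\<not> r * gauge_fn m t < 1"
      then have ge: "1 \<le> r * gauge_fn m t" by simp
      define z where "z = cis (- 2 * t / (real m + 1))"
      have "a * power_sum m z = of_real (real m * (r * gauge_fn m t))"
        using power_sum_on_ray[of m t] m t by (simp add: a_def z_def mult_ac)
      then have gz: "g z = of_real (r * gauge_fn m t)" by (simp only: g1)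
      \<comment> \<open>The constant \<open>a / m\<close> cancels in the logarithmic derivative, so
        the real part is \<open>(m + 1) / 2\<close>.\<close>
      have pos: "0 < Re (w * deriv g w / g w)"
        if w: "norm w = 1" "g w = of_real s" "0 < s" for w s
      proof -
        have "power_sum m w \<noteq> 0" using w by (auto simp: g_def)
        moreover have "deriv g w = a / of_nat m * deriv (power_sum m) w"
          unfolding g_def
          by (intro deriv_cmult holomorphic_on_imp_differentiable_at[OF power_sum_holomorphic open_UNIV]) auto
        then have "w * deriv g w / g w = w * deriv (power_sum m) w / power_sum m w"
          using a0 m by (simp add: g_def)
        ultimately show ?thesis using power_sum_angular_deriv[OF m w(1)] by simp
      qed
      have nz: "norm z \<le> 1" by (simp add: z_def)
      \<comment> \<open>The ray point has a value of at least 1; lowering it to exactly 1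
        contradicts membership.\<close>
      obtain w where "norm w \<le> 1" "g w = of_real 1"
      proof (rule real_value_downward[where g = g and z = z and c = 1, OF hol nc _ nz gz _ ge])
        show "0 < Re (w * deriv g w / g w)" if "norm w = 1" "g w = of_real s" "0 < s" for w s
          using that by (rule pos)
      qed (simp, rule that)
      then show False using a[of w] g1[of w 1] by simp
    qed
  next
    assume lt: "r * gauge_fn m t < 1"
    have "a \<in> MARS_m m"
    proof (rule ccontr)
      assume "a \<notin> MARS_m m"
      then obtain z where z: "norm z \<le> 1" "a * power_sum m z = of_nat m"
        by (auto simp: MARS_m_iff[OF m])
      then have "g z = of_real 1" by (simp only: g1) simp
      then obtain w s where w: "norm w = 1" "g w = of_real s" "1 \<le> s"
        using real_value_on_circle[OF hol nc z(1)] by blast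
      then have "s \<le> r * gauge_fn m t"
        using power_sum_circle_bound[OF m w(1) r t, of s] g1[of w s] by (simp add: a_def)
      then show False using w lt by simp
    qed
    then show "of_real r * cis t \<in> MARS_m m" by (simp add: a_def)
  qed
qed

lemma zero_in_MARS_m: "1 \<le> m \<Longrightarrow> 0 \<in> MARS_m m"
  by (simp add: MARS_m_iff)

lemma cnj_in_MARS_m_iff:
  assumes "1 \<le> m"
  shows "cnj a \<in> MARS_m m \<longleftrightarrow> a \<in> MARS_m m"
proof -
  have *: "cnj a \<in> MARS_m m" if "a \<in> MARS_m m" for a
    unfolding MARS_m_iff[OF assms]
  proof (intro allI impI notI)
    fix z assume z: "norm z \<le> 1" "cnj a * power_sum m z = of_nat m"
    then have "cnj (cnj a * power_sum m z) = of_nat m" by (simp only: complex_cnj_of_nat)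
    then have "a * power_sum m (cnj z) = of_nat m" by (simp add: power_sum_cnj)
    moreover have "norm (cnj z) \<le> 1" using z by simp
    ultimately show False using that MARS_m_iff[OF assms] by blast
  qed
  show ?thesis using *[of a] *[of "cnj a"] by auto
qed

section \<open>Reduction to the upper half plane, monotonicity and convexity\<close>

lemma polar_up_to_cnj:
  assumes "a \<noteq> 0"
  obtains r t where "0 < r" "0 \<le> t" "t \<le> pi"
    "a = of_real r * cis t \<or> cnj a = of_real r * cis t"
proof (rule that)
  have a: "a = of_real (norm a) * cis (Arg a)"
    using rcis_cmod_Arg[of a] by (simp add: rcis_def)
  then have "cnj a = of_real (norm a) * cis (- Arg a)"
    by (metis cis_cnj complex_cnj_complex_of_real complex_cnj_mult)
  then show "a = of_real (norm a) * cis \<bar>Arg a\<bar> \<or> cnj a = of_real (norm a) * cis \<bar>Arg a\<bar>"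
    using a by (auto simp: abs_if)
  show "\<bar>Arg a\<bar> \<le> pi" using Arg_bounded[of a] by auto
qed (use assms in auto)

lemma MARS_m_mono:
  assumes "1 \<le> m" "m \<le> n"
  shows "MARS_m m \<subseteq> MARS_m n"
proof
  fix a assume a: "a \<in> MARS_m m"
  have n: "1 \<le> n" using assms by simp
  show "a \<in> MARS_m n"
  proof (cases "a = 0")
    case True
    then show ?thesis using n by (simp add: zero_in_MARS_m)
  next
    case False
    then obtain r t where r: "0 < r" and t: "0 \<le> t" "t \<le> pi"
      and at: "a = of_real r * cis t \<or> cnj a = of_real r * cis t"
      by (rule polar_up_to_cnj)
    have "of_real r * cis t \<in> MARS_m m" using a at cnj_in_MARS_m_iff[OF assms(1), of a] by auto
    then have "r * gauge_fn m t < 1" using MARS_m_polar_iff[OF assms(1) r t] by simp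
    moreover have "r * gauge_fn n t \<le> r * gauge_fn m t"
      using r t assms by (intro mult_left_mono gauge_fn_antimono) auto
    ultimately have "of_real r * cis t \<in> MARS_m n" using MARS_m_polar_iff[OF n r t] by simp
    then show ?thesis using at cnj_in_MARS_m_iff[OF n, of a] by auto
  qed
qed

text \<open>If a convex combination left the set, its separating functional would be strictly
  smaller at both end points, hence also at the combination itself.\<close>

lemma convexI_separation:
  fixes S :: "'a::real_inner set"
  assumes "\<And>a. a \<notin> S \<Longrightarrow> \<exists>w. \<forall>b\<in>S. inner w b < inner w a"
  shows "convex S"
proof (rule convexI, rule ccontr)
  fix x y :: 'a and u v :: real
  assume xy: "x \<in> S" "y \<in> S" and uv: "0 \<le> u" "0 \<le> v" "u + v = 1"
    and "u *\<^sub>R x + v *\<^sub>R y \<notin> S"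
  then obtain w where w: "\<And>b. b \<in> S \<Longrightarrow> inner w b < inner w (u *\<^sub>R x + v *\<^sub>R y)"
    using assms by blast
  have "u * inner w x + v * inner w y < inner w (u *\<^sub>R x + v *\<^sub>R y)"
    using w xy uv by (intro convex_bound_lt) auto
  then show False by (simp add: inner_add_right)
qed

lemma convex_MARS_m:
  assumes m: "1 \<le> m"
  shows "convex (MARS_m m)"
proof (rule convexI_separation)
  fix a assume a: "a \<notin> MARS_m m"
  then have "a \<noteq> 0" using zero_in_MARS_m[OF m] by auto
  then obtain r t where r: "0 < r" and t: "0 \<le> t" "t \<le> pi"
    and at: "a = of_real r * cis t \<or> cnj a = of_real r * cis t"
    by (rule polar_up_to_cnj)
  obtain p q where q: "0 \<le> q" and pq: "p * cos t + q * sin t = gauge_fn m t"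
    and sup: "\<And>s. 0 \<le> s \<Longrightarrow> s \<le> pi \<Longrightarrow> p * cos s + q * sin s \<le> gauge_fn m s"
    by (rule gauge_fn_support[OF m t]) (rule that)
  define L where "L = (\<lambda>b. p * Re b + q * Im b)"
  have L_less: "L b < 1" if b: "b \<in> MARS_m m" for b
  proof (cases "b = 0")
    case True
    then show ?thesis by (simp add: L_def)
  next
    case False
    then obtain s u where s: "0 < s" and u: "0 \<le> u" "u \<le> pi"
      and bu: "b = of_real s * cis u \<or> cnj b = of_real s * cis u"
      by (rule polar_up_to_cnj)
    define c where "c = of_real s * cis u"
    have "c \<in> MARS_m m" using b bu cnj_in_MARS_m_iff[OF m, of b] by (auto simp: c_def)
    then have "s * gauge_fn m u < 1" using MARS_m_polar_iff[OF m s u] by (simp add: c_def)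
    moreover have "L c = s * (p * cos u + q * sin u)" by (simp add: L_def c_def algebra_simps)
    moreover have "s * (p * cos u + q * sin u) \<le> s * gauge_fn m u"
      using sup[OF u] s by simp
    ultimately have "L c < 1" by simp
    \<comment> \<open>\<open>c\<close> is whichever of \<open>b\<close> and \<open>cnj b\<close>
      lies in the upper half plane; since \<open>q \<ge> 0\<close>, passing to it cannot decrease
      \<open>L\<close>.\<close>
    moreover have "L b \<le> L c"
    proof -
      have "0 \<le> Im c" using s u by (simp add: c_def sin_ge_zero)
      moreover have "Re b = Re c" "Im b = Im c \<or> Im b = - Im c"
        using bu by (auto simp: c_def complex_eq_iff)
      ultimately show ?thesis using q by (auto simp: L_def intro: order_trans[of _ 0])
    qed
    ultimately show ?thesis by simp
  qed
  define c where "c = of_real r * cis t"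
  have "c \<notin> MARS_m m" using a at cnj_in_MARS_m_iff[OF m, of a] by (auto simp: c_def)
  then have "1 \<le> r * gauge_fn m t" using MARS_m_polar_iff[OF m r t] by (simp add: c_def)
  \<comment> \<open>The tangent condition at \<open>t\<close>: along this ray \<open>L\<close> is
    the radius times the gauge.\<close>
  also have "\<dots> = L c" by (simp add: L_def c_def algebra_simps flip: pq)
  finally have Lc: "1 \<le> L c" .
  show "\<exists>w. \<forall>b\<in>MARS_m m. inner w b < inner w a"
    using at
  proof
    assume "a = of_real r * cis t"
    then have "inner (Complex p q) a = L c" by (simp add: L_def inner_complex_def c_def)
    moreover have "inner (Complex p q) b = L b" for b by (simp add: L_def inner_complex_def)
    ultimately have "\<forall>b\<in>MARS_m m. inner (Complex p q) b < inner (Complex p q) a"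
      using L_less Lc by (metis less_le_trans)
    then show ?thesis ..
  next
    \<comment> \<open>For \<open>a\<close> in the lower half plane the normal is reflected to
      \<open>(p, -q)\<close>, and conjugation invariance transfers the bound.\<close>
    assume "cnj a = of_real r * cis t"
    then have "L c = L (cnj a)" by (simp add: c_def)
    then have La: "inner (Complex p (- q)) a = L c" by (simp add: L_def inner_complex_def)
    have "inner (Complex p (- q)) b < inner (Complex p (- q)) a" if "b \<in> MARS_m m" for b
    proof -
      have "inner (Complex p (- q)) b = L (cnj b)" by (simp add: L_def inner_complex_def)
      also have "\<dots> < 1" using that by (intro L_less) (simp add: cnj_in_MARS_m_iff[OF m])
      finally show ?thesis using La Lc by simp
    qed
    then show ?thesis by blast
  qed
qed

theorem theorem10p2:
  shows "(\<forall>m::nat. m \<ge> 1 \<longrightarrow> convex (MARS_m m))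
    \<and> (\<forall>m n::nat. 1 \<le> m \<and> m \<le> n \<longrightarrow> MARS_m m \<subseteq> MARS_m n)
    \<and> convex MARS"
proof (intro conjI allI impI)
  show "convex MARS"
  proof (rule convexI)
    fix x y :: complex and u v :: real
    assume "x \<in> MARS" "y \<in> MARS" and uv: "0 \<le> u" "0 \<le> v" "u + v = 1"
    then obtain m n where mn: "1 \<le> m" "x \<in> MARS_m m" "1 \<le> n" "y \<in> MARS_m n"
      by (auto simp: MARS_def)
    \<comment> \<open>Monotonicity puts both points into one convex member of the chain.\<close>
    then have "x \<in> MARS_m (max m n)" "y \<in> MARS_m (max m n)"
      using MARS_m_mono[of m "max m n"] MARS_m_mono[of n "max m n"] by auto
    moreover have "1 \<le> max m n" using mn by simp
    ultimately show "u *\<^sub>R x + v *\<^sub>R y \<in> MARS"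
      using convexD[OF convex_MARS_m _ _ uv] by (auto simp: MARS_def)
  qed
qed (use convex_MARS_m MARS_m_mono in blast)+

end
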